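(* For every planar binary rooted tree $t\in\mathbf{PBT}_n$ ($n\geq 1$), $$\overset{\circledast}{\Delta}(M_t)=\sum_{z_1\rightthreetimes z_2=t} M_{z_1}\otimes M_{z_2},$$ where the sum runs over all pairs $(z_1,z_2)$ with $z_1,z_2\in\{1_{\mathbb K}\}\cup\bigcup_{m\geq1}\mathbf{PBT}_m$ such that $z_1\rightthreetimes z_2=t$, and $M_{1_{\mathbb K}}:=1_{\mathbb K}$.
   Context: A planar binary rooted tree is a planar rooted tree in which every internal vertex has exactly two incoming edges (children) and one outgoing edge; $\mathbf{PBT}_n$ is the set of such trees with $n$ leaves (hence $n-1$ internal vertices), leaves numbered $1,\dots,n$ from left to right; $\mathbf{PBT}_1=\{\vert\}$ (the tree with one leaf and no internal vertex). For trees $t,w$, $t\veebar w$ is the tree obtained by joining the roots of $t$ (on the left) and $w$ (on the right) to a new root; every tree with at least two leaves is uniquely $t^l\veebar t^r$. For $t\in\mathbf{PBT}_n$, $w$ a tree, $1\le j\le n$, $t\circ_j w$ is the tree obtained by identifying the root of $w$ with the $j$-th leaf of $t$. Let $\mathcal H=\mathbb K 1_{\mathbb K}\oplus\bigoplus_{n\ge1}\mathbb K[\mathbf{PBT}_n]$ ($1_{\mathbb K}$ of degree $0$); all operations are extended (multi)linearly. The product $\rightthreetimes$ on $\mathcal H$: $1_{\mathbb K}\rightthreetimes t=t=t\rightthreetimes 1_{\mathbb K}$, and $t\rightthreetimes w=w\circ_1(t\veebar\vert)$ for trees $t,w$. The coproduct $\overset{\circledast}{\Delta}:\mathcal H\to\mathcal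 H\otimes\mathcal H$ is defined recursively by $\overset{\circledast}{\Delta}(1_{\mathbb K})=1_{\mathbb K}\otimes1_{\mathbb K}$, $\overset{\circledast}{\Delta}(\vert)=1_{\mathbb K}\otimes\vert+\vert\otimes1_{\mathbb K}$, and $\overset{\circledast}{\Delta}(t\veebar w)=\sum t_{(1)}\otimes(t_{(2)}\veebar w)+\sum(t\veebar w_{(1)})\otimes w_{(2)}-t\otimes w$, where $\overset{\circledast}{\Delta}(x)=\sum x_{(1)}\otimes x_{(2)}$ and with the conventions $1_{\mathbb K}\veebar w=w$, $t\veebar 1_{\mathbb K}=t$. The Tamari order $\le_T$ on $\mathbf{PBT}_n$ is the partial order generated by $(t_1\veebar t_2)\veebar t_3\le_T t_1\veebar(t_2\veebar t_3)$ and by: $t_1\le_T w_1$, $t_2\le_T w_2$ imply $t_1\veebar t_2\le_T w_1\veebar w_2$ (equivalently, the reflexive–transitive closure of right rotations at internal vertices). With $\mu$ the Möbius function of $(\mathbf{PBT}_n,\le_T)$, $M_t:=\sum_{w\le_T t}\mu(w,t)\,w$. *)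

theory Defs
  imports "HOL-Library.Poly_Mapping"
begin

section \<open>Planar binary rooted trees\<close>

datatype pbt = Leaf | Join pbt pbt  (infixl \<open>\<veebar>\<close> 70)

fun leaves :: "pbt \<Rightarrow> nat" where
  "leaves Leaf = 1"
| "leaves (l \<veebar> r) = leaves l + leaves r"

definition PBT :: "nat \<Rightarrow> pbt set" where
  "PBT n = {t. leaves t = n}"

text \<open>\<open>graft t j w\<close> identifies the root of \<open>w\<close> with the \<open>j\<close>-th leaf of \<open>t\<close> and is meaningful
  only for \<open>1 \<le> j \<le> leaves t\<close>.\<close>

fun graft :: "pbt \<Rightarrow> nat \<Rightarrow> pbt \<Rightarrow> pbt" where
  "graft Leaf j w = w"
| "graft (l \<veebar> r) j w =
     (if j \<le> leaves l then graft l j w \<veebar> r else l \<veebar> graft r (j - leaves l) w)"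

section \<open>The Tamari order and its Moebius function\<close>

inductive tamari_le :: "pbt \<Rightarrow> pbt \<Rightarrow> bool"  (infix \<open>\<le>\<^sub>T\<close> 50) where
  refl: "t \<le>\<^sub>T t"
| trans: "t \<le>\<^sub>T u \<Longrightarrow> u \<le>\<^sub>T v \<Longrightarrow> t \<le>\<^sub>T v"
| rotate: "(t1 \<veebar> t2) \<veebar> t3 \<le>\<^sub>T t1 \<veebar> (t2 \<veebar> t3)"
| join: "t1 \<le>\<^sub>T w1 \<Longrightarrow> t2 \<le>\<^sub>T w2 \<Longrightarrow> t1 \<veebar> t2 \<le>\<^sub>T w1 \<veebar> w2"

lemma tamari_le_leaves: "t \<le>\<^sub>T w \<Longrightarrow> leaves t = leaves w"
  by (induction rule: tamari_le.induct) auto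

text \<open>A statistic that strictly increases along the Tamari order. It yields antisymmetry and the
  termination of the recursion for the Moebius function.\<close>

fun right_weight :: "pbt \<Rightarrow> nat" where
  "right_weight Leaf = 0"
| "right_weight (l \<veebar> r) = right_weight l + right_weight r + leaves r"

lemma leaves_pos: "0 < leaves t"
  by (induction t) auto

lemma right_weight_mono: "t \<le>\<^sub>T w \<Longrightarrow> t = w \<or> right_weight t < right_weight w"
proof (induction rule: tamari_le.induct)
  case (rotate t1 t2 t3)
  then show ?case using leaves_pos[of t3] by simp
next
  case (join t1 w1 t2 w2)
  then show ?case using tamari_le_leaves[of t2 w2] by auto
qed auto

lemma tamari_le_antisym: "t \<le>\<^sub>T w \<Longrightarrow> w \<le>\<^sub>T t \<Longrightarrow> t = w"
  using right_weight_mono[of t w] right_weight_mono[of w t] by auto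

lemma finite_PBT_le: "finite {t. leaves t \<le> n}"
proof (induction n)
  case 0
  have "{t. leaves t \<le> 0} = {}" using leaves_pos by (metis (mono_tags) Collect_empty_eq not_le)
  then show ?case by (metis finite.emptyI)
next
  case (Suc n)
  have "{t. leaves t \<le> Suc n}
      \<subseteq> insert Leaf ((\<lambda>(l, r). l \<veebar> r) ` ({t. leaves t \<le> n} \<times> {t. leaves t \<le> n}))"
  proof
    fix t assume "t \<in> {t. leaves t \<le> Suc n}"
    then show "t \<in> insert Leaf ((\<lambda>(l, r). l \<veebar> r) ` ({t. leaves t \<le> n} \<times> {t. leaves t \<le> n}))"
    proof (cases t)
      case (Join l r)
      with \<open>t \<in> _\<close> leaves_pos[of l] leaves_pos[of r]
      have "leaves l \<le> n" "leaves r \<le> n" by auto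
      with Join show ?thesis by auto
    qed simp
  qed
  with Suc show ?case by (meson finite.insertI finite_SigmaI finite_imageI finite_subset)
qed

lemma finite_PBT: "finite (PBT n)"
  by (rule finite_subset[OF _ finite_PBT_le[of n]]) (auto simp: PBT_def)

lemma finite_tamari_below: "finite {w. w \<le>\<^sub>T t}"
  by (rule finite_subset[OF _ finite_PBT[of "leaves t"]])
    (auto simp: PBT_def tamari_le_leaves)

text \<open>Tamari-comparable trees have the same number of leaves, so this is, simultaneously for all
  \<open>n\<close>, the Moebius function of the finite poset \<open>PBT n\<close>.\<close>

function mobius :: "pbt \<Rightarrow> pbt \<Rightarrow> int" where
  "mobius s t =
     (if s = t then 1
      else if s \<le>\<^sub>T t then - (\<Sum>u | s \<le>\<^sub>T u \<and> u \<le>\<^sub>T t \<and> u \<noteq> t. mobius s u)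
      else 0)"
  by pat_completeness auto
termination
  by (relation "measure (\<lambda>(s, t). right_weight t)") (use right_weight_mono in auto)

declare mobius.simps [simp del]

section \<open>The space \<open>\<H>\<close> and its tensor square\<close>

text \<open>The homogeneous basis of \<open>\<H>\<close>: \<open>None\<close> is the degree-zero element \<open>1\<^sub>K\<close>. The tensor square of
  \<open>\<H>\<close> is the free vector space on pairs of basis elements.\<close>

type_synonym basis = "pbt option"
type_synonym 'k H = "basis \<Rightarrow>\<^sub>0 'k"
type_synonym 'k HH = "basis \<times> basis \<Rightarrow>\<^sub>0 'k"

definition lin_ext :: "('a \<Rightarrow> 'b \<Rightarrow>\<^sub>0 'k::field) \<Rightarrow> ('a \<Rightarrow>\<^sub>0 'k) \<Rightarrow> ('b \<Rightarrow>\<^sub>0 'k)" where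
  "lin_ext f x =
     (\<Sum>a\<in>Poly_Mapping.keys x. Poly_Mapping.map ((*) (Poly_Mapping.lookup x a)) (f a))"

definition tensor :: "'k::field H \<Rightarrow> 'k H \<Rightarrow> 'k HH"  (infixl \<open>\<otimes>\<close> 70) where
  "x \<otimes> y = (\<Sum>a\<in>Poly_Mapping.keys x. \<Sum>b\<in>Poly_Mapping.keys y.
     Poly_Mapping.single (a, b) (Poly_Mapping.lookup x a * Poly_Mapping.lookup y b))"

section \<open>Product and coproduct\<close>

text \<open>The product sends a pair of basis elements to a basis element, and only its values on basis
  elements are needed.\<close>

fun rprod :: "basis \<Rightarrow> basis \<Rightarrow> basis"  (infixl \<open>\<rightthreetimes>\<close> 70) where
  "None \<rightthreetimes> z = z"
| "z \<rightthreetimes> None = z"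
| "Some t \<rightthreetimes> Some w = Some (graft w 1 (t \<veebar> Leaf))"

lemma leaves_graft:
  "1 \<le> j \<Longrightarrow> j \<le> leaves t \<Longrightarrow> leaves (graft t j w) + 1 = leaves t + leaves w"
proof (induction t arbitrary: j)
  case (Join l r)
  then show ?case using Join.IH(2)[of "j - leaves l"] by auto
qed auto

lemma finite_rprod_factors: "finite {(z1, z2). z1 \<rightthreetimes> z2 = Some t}"
proof -
  let ?B = "insert None (Some ` {w. leaves w \<le> leaves t})"
  have "{(z1, z2). z1 \<rightthreetimes> z2 = Some t} \<subseteq> ?B \<times> ?B"
  proof clarify
    fix z1 z2 assume eq: "z1 \<rightthreetimes> z2 = Some t"
    show "z1 \<in> ?B \<and> z2 \<in> ?B"
    proof (cases z1; cases z2)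
      fix u v assume z: "z1 = Some u" "z2 = Some v"
      with eq have "leaves t + 1 = leaves v + (leaves u + 1)"
        using leaves_graft[of 1 v "u \<veebar> Leaf"] leaves_pos[of v] by auto
      then have "leaves u \<le> leaves t" "leaves v \<le> leaves t" by auto
      with z show ?thesis by auto
    qed (use eq in auto)
  qed
  moreover have "finite (?B \<times> ?B)" using finite_PBT_le by blast
  ultimately show ?thesis by (rule finite_subset)
qed

text \<open>The join \<open>\<veebar>\<close> with the conventions \<open>1\<^sub>K \<veebar> w = w\<close> and \<open>t \<veebar> 1\<^sub>K = t\<close>.\<close>

fun join1 :: "basis \<Rightarrow> basis \<Rightarrow> basis" where
  "join1 None z = z"
| "join1 z None = z"
| "join1 (Some t) (Some w) = Some (t \<veebar> w)"

fun coprod_tree :: "pbt \<Rightarrow> 'k::field HH" where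
  "coprod_tree Leaf =
     Poly_Mapping.single (None, Some Leaf) 1 + Poly_Mapping.single (Some Leaf, None) 1"
| "coprod_tree (t \<veebar> w) =
     lin_ext (\<lambda>(a, b). Poly_Mapping.single (a, join1 b (Some w)) 1) (coprod_tree t)
   + lin_ext (\<lambda>(a, b). Poly_Mapping.single (join1 (Some t) a, b) 1) (coprod_tree w)
   - Poly_Mapping.single (Some t, Some w) 1"

fun coprod_basis :: "basis \<Rightarrow> 'k::field HH" where
  "coprod_basis None = Poly_Mapping.single (None, None) 1"
| "coprod_basis (Some t) = coprod_tree t"

definition coprod :: "'k::field H \<Rightarrow> 'k HH" where
  "coprod = lin_ext coprod_basis"

section \<open>The basis \<open>M\<close>\<close>

fun M :: "basis \<Rightarrow> 'k::field H" where
  "M None = Poly_Mapping.single None 1"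
| "M (Some t) = (\<Sum>w | w \<le>\<^sub>T t. Poly_Mapping.single (Some w) (of_int (mobius w t)))"

end

theory Submission
  imports Defs
begin

text \<open>The coproduct cuts a tree \<open>t\<close> at every gap between its leaves: it is the sum, over
  \<open>i = 0, \<dots>, n\<close>, of the restriction \<open>lcut i t\<close> of \<open>t\<close> to its first \<open>i\<close> leaves tensored with its
  restriction \<open>rcut i t\<close> to the other leaves. Both restrictions are monotone for the Tamari order,
  and they form an adjunction with the product: for \<open>z1\<close> with \<open>i\<close> leaves, \<open>z1 \<rightthreetimes> z2 \<le> t\<close> holds
  if and only if \<open>z1 \<le> lcut i t\<close> and \<open>z2 \<le> rcut i t\<close>. Since the sum of \<open>M w\<close> over \<open>w \<le> t\<close> is \<open>t\<close>,
  both sides of the claim have the same sum over every principal down-set, so they agree.\<close>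

section \<open>Linear and bilinear extension\<close>

text \<open>Allowing any finite \<open>S\<close> that contains the support lets several vectors be
  evaluated over one common index set, as additivity requires.\<close>

lemma lookup_lin_ext:
  assumes "finite S" "Poly_Mapping.keys x \<subseteq> S"
  shows "Poly_Mapping.lookup (lin_ext f x) b =
    (\<Sum>a\<in>S. Poly_Mapping.lookup x a * Poly_Mapping.lookup (f a) b)"
proof -
  have "Poly_Mapping.lookup (lin_ext f x) b =
      (\<Sum>a\<in>Poly_Mapping.keys x. Poly_Mapping.lookup x a * Poly_Mapping.lookup (f a) b)"
    unfolding lin_ext_def lookup_sum
    by (rule sum.cong) (auto simp: Poly_Mapping.map.rep_eq when_def)
  also have "\<dots> = (\<Sum>a\<in>S. Poly_Mapping.lookup x a * Poly_Mapping.lookup (f a) b)"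
    using assms by (intro sum.mono_neutral_left) (auto simp: in_keys_iff)
  finally show ?thesis .
qed

lemma lin_ext_single [simp]: "lin_ext f (Poly_Mapping.single a 1) = f a"
  by (rule poly_mapping_eqI) (simp add: lookup_lin_ext[of "{a}"])

lemma lin_ext_zero [simp]: "lin_ext f 0 = 0"
  by (simp add: lin_ext_def)

lemma lin_ext_add: "lin_ext f (x + y) = lin_ext f x + lin_ext f y"
proof (rule poly_mapping_eqI)
  fix b
  let ?S = "Poly_Mapping.keys x \<union> Poly_Mapping.keys y"
  have "Poly_Mapping.keys (x + y) \<subseteq> ?S" by (rule Poly_Mapping.keys_add)
  then show "Poly_Mapping.lookup (lin_ext f (x + y)) b =
      Poly_Mapping.lookup (lin_ext f x + lin_ext f y) b"
    by (simp add: lookup_lin_ext[of ?S] lookup_add sum.distrib algebra_simps)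
qed

lemma lin_ext_sum: "lin_ext f (\<Sum>i\<in>A. g i) = (\<Sum>i\<in>A. lin_ext f (g i))"
  by (induction A rule: infinite_finite_induct) (auto simp: lin_ext_add)

lemma lookup_tensor:
  "Poly_Mapping.lookup (x \<otimes> y) (a, b) = Poly_Mapping.lookup x a * Poly_Mapping.lookup y b"
proof -
  have "Poly_Mapping.lookup (x \<otimes> y) (a, b) =
      (\<Sum>a'\<in>Poly_Mapping.keys x. \<Sum>b'\<in>Poly_Mapping.keys y.
        if a' = a then if b' = b then Poly_Mapping.lookup x a * Poly_Mapping.lookup y b
        else 0 else 0)"
    unfolding tensor_def lookup_sum
    by (intro sum.cong refl) (auto simp: lookup_single when_def)
  also have "\<dots> = (\<Sum>a'\<in>Poly_Mapping.keys x. if a' = a then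
      if b \<in> Poly_Mapping.keys y then Poly_Mapping.lookup x a * Poly_Mapping.lookup y b
      else 0 else 0)"
    by (intro sum.cong refl) (auto simp: sum.delta)
  also have "\<dots> = Poly_Mapping.lookup x a * Poly_Mapping.lookup y b"
    by (auto simp: sum.delta in_keys_iff)
  finally show ?thesis .
qed

lemma tensor_single:
  "Poly_Mapping.single a 1 \<otimes> Poly_Mapping.single b 1 = Poly_Mapping.single (a, b) 1"
proof (rule poly_mapping_eqI)
  fix k :: "basis \<times> basis"
  show "Poly_Mapping.lookup (Poly_Mapping.single a 1 \<otimes> Poly_Mapping.single b 1) k =
      Poly_Mapping.lookup (Poly_Mapping.single (a, b) 1) k"
    by (cases k) (auto simp: lookup_tensor lookup_single when_def)
qed

lemma tensor_sum: "(\<Sum>i\<in>A. x i) \<otimes> (\<Sum>j\<in>B. y j) = (\<Sum>(i, j)\<in>A \<times> B. x i \<otimes> y j)"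
proof (rule poly_mapping_eqI)
  fix k :: "basis \<times> basis"
  show "Poly_Mapping.lookup ((\<Sum>i\<in>A. x i) \<otimes> (\<Sum>j\<in>B. y j)) k =
      Poly_Mapping.lookup (\<Sum>(i, j)\<in>A \<times> B. x i \<otimes> y j) k"
    by (cases k) (simp add: lookup_tensor lookup_sum sum_product
        flip: sum.cartesian_product)
qed

section \<open>The Tamari order with a unit adjoined\<close>

text \<open>\<open>rel_option\<close> makes the unit comparable only to itself, so comparable
  elements still have equal degree.\<close>

abbreviation basis_le :: "basis \<Rightarrow> basis \<Rightarrow> bool"  (infix \<open>\<le>\<^sub>B\<close> 50) where
  "basis_le \<equiv> rel_option tamari_le"

fun bleaves :: "basis \<Rightarrow> nat" where
  "bleaves None = 0"
| "bleaves (Some t) = leaves t"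

lemma basis_le_refl [simp]: "z \<le>\<^sub>B z"
  by (cases z) (auto intro: tamari_le.refl)

lemma basis_le_trans [trans]: "x \<le>\<^sub>B y \<Longrightarrow> y \<le>\<^sub>B z \<Longrightarrow> x \<le>\<^sub>B z"
  by (cases x; cases y; cases z) (auto intro: tamari_le.trans)

lemma basis_le_bleaves: "x \<le>\<^sub>B y \<Longrightarrow> bleaves x = bleaves y"
  by (cases x; cases y) (auto dest: tamari_le_leaves)

lemma basis_le_Some_iff: "z \<le>\<^sub>B Some t \<longleftrightarrow> (\<exists>w. z = Some w \<and> w \<le>\<^sub>T t)"
  by (cases z) auto

lemma below_Some: "{z. z \<le>\<^sub>B Some t} = Some ` {w. w \<le>\<^sub>T t}"
  by (auto simp: basis_le_Some_iff)

lemma below_None: "{z. z \<le>\<^sub>B None} = {None}"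
  by auto

lemma join1_None_right [simp]: "join1 a None = a"
  by (cases a) auto

lemma bleaves_join1: "bleaves (join1 a b) = bleaves a + bleaves b"
  by (cases a; cases b) auto

lemma join1_mono: "a \<le>\<^sub>B a' \<Longrightarrow> b \<le>\<^sub>B b' \<Longrightarrow> join1 a b \<le>\<^sub>B join1 a' b'"
  by (cases a; cases a'; cases b; cases b') (auto intro: tamari_le.join)

text \<open>If one of the three is the unit, the two sides coincide; otherwise this is a
  rotation.\<close>

lemma join1_rotate: "join1 (join1 a b) c \<le>\<^sub>B join1 a (join1 b c)"
  by (cases a; cases b; cases c) (auto intro: tamari_le.intros)

section \<open>Cutting a tree at a gap between leaves\<close>

text \<open>Truncated subtraction makes the two cases of a cut to the left and to the right of the root
  uniform: if \<open>i \<le> leaves l\<close>, the right subtree is cut at \<open>0\<close>, and if \<open>i \<ge> leaves l\<close>, the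
  left subtree lies entirely to the left of the cut.\<close>

fun lcut :: "nat \<Rightarrow> pbt \<Rightarrow> basis" where
  "lcut i Leaf = (if i = 0 then None else Some Leaf)"
| "lcut i (l \<veebar> r) = join1 (lcut i l) (lcut (i - leaves l) r)"

fun rcut :: "nat \<Rightarrow> pbt \<Rightarrow> basis" where
  "rcut i Leaf = (if i = 0 then Some Leaf else None)"
| "rcut i (l \<veebar> r) = join1 (rcut i l) (rcut (i - leaves l) r)"

lemma lcut_0 [simp]: "lcut 0 t = None"
  by (induction t) auto

lemma rcut_0 [simp]: "rcut 0 t = Some t"
  by (induction t) auto

lemma lcut_all: "leaves t \<le> i \<Longrightarrow> lcut i t = Some t"
  by (induction t arbitrary: i) auto

lemma rcut_all: "leaves t \<le> i \<Longrightarrow> rcut i t = None"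
  by (induction t arbitrary: i) auto

lemma bleaves_lcut: "bleaves (lcut i t) = min i (leaves t)"
  by (induction t arbitrary: i) (auto simp: bleaves_join1)

text \<open>A rotation leaves the cuts of its three subtrees unchanged, so
  \<open>join1_rotate\<close> applies. In a join, comparable left subtrees have equally many leaves,
  so both right subtrees are cut at the same place.\<close>

lemma lcut_mono: "s \<le>\<^sub>T t \<Longrightarrow> lcut i s \<le>\<^sub>B lcut i t"
proof (induction arbitrary: i rule: tamari_le.induct)
  case (trans t u v)
  then show ?case by (blast intro: basis_le_trans)
next
  case (rotate t1 t2 t3)
  then show ?case by (simp add: join1_rotate diff_diff_left)
next
  case (join t1 w1 t2 w2)
  then show ?case by (simp add: join1_mono tamari_le_leaves)
qed simp

lemma rcut_mono: "s \<le>\<^sub>T t \<Longrightarrow> rcut i s \<le>\<^sub>B rcut i t"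
proof (induction arbitrary: i rule: tamari_le.induct)
  case (trans t u v)
  then show ?case by (blast intro: basis_le_trans)
next
  case (rotate t1 t2 t3)
  then show ?case by (simp add: join1_rotate diff_diff_left)
next
  case (join t1 w1 t2 w2)
  then show ?case by (simp add: join1_mono tamari_le_leaves)
qed simp

text \<open>The two sums of the recursion are the cuts through the left and through the right
  subtree. The gap between the subtrees occurs in both, and the subtracted term removes the
  repetition.\<close>

lemma coprod_tree_eq_cuts:
  "(coprod_tree t :: 'k::field HH) =
    (\<Sum>i\<le>leaves t. Poly_Mapping.single (lcut i t, rcut i t) 1)"
proof (induction t)
  case Leaf
  then show ?case by simp
next
  case (Join l r)
  let ?t = "l \<veebar> r"
  let ?g = "\<lambda>i. Poly_Mapping.single (lcut i ?t, rcut i ?t) (1::'k)"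
  have left: "lin_ext (\<lambda>(a, b). Poly_Mapping.single (a, join1 b (Some r)) 1) (coprod_tree l)
      = (\<Sum>i\<le>leaves l. ?g i)"
    unfolding Join lin_ext_sum by (intro sum.cong) auto
  have right: "lin_ext (\<lambda>(a, b). Poly_Mapping.single (join1 (Some l) a, b) 1) (coprod_tree r)
      = (\<Sum>j\<le>leaves r. ?g (j + leaves l))"
    unfolding Join lin_ext_sum by (intro sum.cong) (auto simp: lcut_all rcut_all)
  have "(\<Sum>i\<le>leaves ?t. ?g i) = (\<Sum>i\<le>leaves l. ?g i) + (\<Sum>i=Suc (leaves l)..leaves ?t. ?g i)"
    by (simp add: sum_up_index_split del: lcut.simps rcut.simps)
  also have "(\<Sum>i=Suc (leaves l)..leaves ?t. ?g i) = (\<Sum>j=Suc 0..leaves r. ?g (j + leaves l))"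
    using sum.shift_bounds_cl_nat_ivl[of ?g "Suc 0" "leaves l" "leaves r"]
    by (simp add: add.commute del: lcut.simps rcut.simps)
  \<comment> \<open>The term \<open>j = 0\<close> is the cut at the gap between \<open>l\<close> and
    \<open>r\<close>, already counted on the left.\<close>
  also have "\<dots> = (\<Sum>j\<le>leaves r. ?g (j + leaves l)) - ?g (leaves l)"
    by (simp add: atMost_atLeast0 sum.atLeast_Suc_atMost del: lcut.simps rcut.simps)
  also have "?g (leaves l) = Poly_Mapping.single (Some l, Some r) 1"
    by (simp add: lcut_all rcut_all)
  finally show ?case by (simp only: coprod_tree.simps left right) simp
qed

section \<open>The adjunction between cuts and the product\<close>

lemma rprod_None_right [simp]: "z \<rightthreetimes> None = z"
  by (cases z) auto

text \<open>The first leaf of \<open>l \<veebar> r\<close> lies in \<open>l\<close>, so the grafting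
  happens there.\<close>

lemma rprod_Join: "Some s \<rightthreetimes> Some (l \<veebar> r) = join1 (Some s \<rightthreetimes> Some l) (Some r)"
  using leaves_pos[of l] by simp

lemma rprod_join1: "z \<rightthreetimes> Some (l \<veebar> r) = join1 (z \<rightthreetimes> Some l) (Some r)"
  by (cases z) (simp_all only: rprod_Join, simp)

lemma bleaves_rprod: "bleaves (z1 \<rightthreetimes> z2) = bleaves z1 + bleaves z2"
proof (cases z1; cases z2)
  fix s t assume "z1 = Some s" "z2 = Some t"
  then show ?thesis using leaves_graft[of 1 t "s \<veebar> Leaf"] leaves_pos[of t] by auto
qed auto

lemma graft_mono_left: "v \<le>\<^sub>T w \<Longrightarrow> graft v 1 s \<le>\<^sub>T graft w 1 s"
proof (induction rule: tamari_le.induct)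
  case (rotate t1 t2 t3)
  then show ?case using leaves_pos[of t1] by (auto intro: tamari_le.rotate)
next
  case (join t1 w1 t2 w2)
  then show ?case using leaves_pos[of t1] leaves_pos[of w1] by (auto intro: tamari_le.join)
qed (auto intro: tamari_le.intros)

lemma graft_mono_right: "s \<le>\<^sub>T s' \<Longrightarrow> graft w j s \<le>\<^sub>T graft w j s'"
  by (induction w arbitrary: j) (auto intro: tamari_le.intros)

lemma rprod_mono: "a \<le>\<^sub>B a' \<Longrightarrow> b \<le>\<^sub>B b' \<Longrightarrow> a \<rightthreetimes> b \<le>\<^sub>B a' \<rightthreetimes> b'"
  by (cases a; cases a'; cases b; cases b')
    (auto intro: tamari_le.trans[OF graft_mono_left graft_mono_right] tamari_le.intros
      simp flip: One_nat_def)

text \<open>Rotations carry \<open>s\<close> up the left spine of \<open>b\<close> to the root, one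
  for each vertex passed.\<close>

lemma join1_rprod_le: "join1 (Some s) a \<rightthreetimes> b \<le>\<^sub>B join1 (Some s) (a \<rightthreetimes> b)"
proof (cases b)
  case (Some w)
  have "join1 (Some s) a \<rightthreetimes> Some w \<le>\<^sub>B join1 (Some s) (a \<rightthreetimes> Some w)"
  proof (induction w)
    case Leaf
    then show ?case by (cases a) (auto intro: tamari_le.intros)
  next
    case (Join l r)
    have "join1 (join1 (Some s) a \<rightthreetimes> Some l) (Some r)
        \<le>\<^sub>B join1 (join1 (Some s) (a \<rightthreetimes> Some l)) (Some r)"
      by (rule join1_mono[OF Join(1) basis_le_refl])
    also have "\<dots> \<le>\<^sub>B join1 (Some s) (join1 (a \<rightthreetimes> Some l) (Some r))"
      by (rule join1_rotate)
    finally show ?case by (simp only: rprod_join1)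
  qed
  then show ?thesis using Some by simp
qed simp

text \<open>This is the counit of the adjunction. A cut inside \<open>l\<close> leaves
  \<open>r\<close> attached on the right; any other cut leaves \<open>l\<close> as a left factor,
  which \<open>join1_rprod_le\<close> moves out of the product.\<close>

lemma lcut_rprod_rcut_le: "lcut i t \<rightthreetimes> rcut i t \<le>\<^sub>B Some t"
proof (induction t arbitrary: i)
  case Leaf
  then show ?case by (simp add: tamari_le.refl)
next
  case (Join l r)
  show ?case
  proof (cases "i < leaves l")
    case True
    \<comment> \<open>Were the right part the unit, the induction hypothesis would give
      \<open>lcut i l\<close> as many leaves as \<open>l\<close>, but it has only
      \<open>i\<close>.\<close>
    then obtain b where b: "rcut i l = Some b"
      by (cases "rcut i l") (use Join(1)[of i] bleaves_lcut[of i l] in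
        \<open>auto dest: basis_le_bleaves\<close>)
    have "lcut i l \<rightthreetimes> Some (b \<veebar> r) \<le>\<^sub>B join1 (Some l) (Some r)"
      unfolding rprod_join1 using Join(1)[of i] b by (intro join1_mono) (auto intro: tamari_le.refl)
    then show ?thesis using True b by simp
  next
    case False
    let ?j = "i - leaves l"
    have "join1 (Some l) (lcut ?j r) \<rightthreetimes> rcut ?j r \<le>\<^sub>B
        join1 (Some l) (lcut ?j r \<rightthreetimes> rcut ?j r)"
      by (rule join1_rprod_le)
    also have "\<dots> \<le>\<^sub>B join1 (Some l) (Some r)"
      using Join(2) by (intro join1_mono) (auto intro: tamari_le.refl)
    finally show ?thesis using False by (simp add: lcut_all rcut_all)
  qed
qed

text \<open>The leaves of \<open>s\<close> come first in the product, and the extra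
  \<open>Leaf\<close> beside \<open>s\<close> takes the place of the first leaf of
  \<open>w\<close>.\<close>

lemma cut_graft:
  "lcut (leaves s) (graft w 1 (s \<veebar> Leaf)) = Some s \<and>
   rcut (leaves s) (graft w 1 (s \<veebar> Leaf)) = Some w"
proof (induction w)
  case Leaf
  then show ?case by (simp add: lcut_all rcut_all)
next
  case (Join l r)
  have "leaves s \<le> leaves (graft l 1 (s \<veebar> Leaf))"
    using leaves_graft[of 1 l "s \<veebar> Leaf"] leaves_pos[of l] by simp
  then show ?case using Join leaves_pos[of l] by simp
qed

text \<open>Thus a factorization of \<open>t\<close> is determined by the number of leaves of its
  first factor.\<close>

lemma cut_rprod:
  assumes "z1 \<rightthreetimes> z2 = Some t"
  shows "lcut (bleaves z1) t = z1" "rcut (bleaves z1) t = z2"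
  using assms cut_graft by (cases z1; cases z2; auto simp: lcut_all rcut_all)+

text \<open>From left to right, multiply the two inequalities and use the counit; conversely, cut
  the product at \<open>i\<close>, which recovers its factors, and use that cuts are
  monotone.\<close>

lemma rprod_le_iff_cuts:
  assumes "i \<le> leaves t"
  shows "z1 \<le>\<^sub>B lcut i t \<and> z2 \<le>\<^sub>B rcut i t \<longleftrightarrow> bleaves z1 = i \<and> z1 \<rightthreetimes> z2 \<le>\<^sub>B Some t"
proof
  assume "z1 \<le>\<^sub>B lcut i t \<and> z2 \<le>\<^sub>B rcut i t"
  then show "bleaves z1 = i \<and> z1 \<rightthreetimes> z2 \<le>\<^sub>B Some t"
    using assms rprod_mono[of z1 "lcut i t" z2 "rcut i t"] lcut_rprod_rcut_le[of i t]
    by (auto dest: basis_le_bleaves simp: bleaves_lcut intro: basis_le_trans)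
next
  assume *: "bleaves z1 = i \<and> z1 \<rightthreetimes> z2 \<le>\<^sub>B Some t"
  then obtain w where w: "z1 \<rightthreetimes> z2 = Some w" "w \<le>\<^sub>T t"
    by (auto simp: basis_le_Some_iff)
  show "z1 \<le>\<^sub>B lcut i t \<and> z2 \<le>\<^sub>B rcut i t"
    using lcut_mono[OF w(2), of i] rcut_mono[OF w(2), of i] cut_rprod[OF w(1)] * by simp
qed

section \<open>Moebius inversion\<close>

lemma sum_mobius:
  assumes "s \<le>\<^sub>T t"
  shows "(\<Sum>u | s \<le>\<^sub>T u \<and> u \<le>\<^sub>T t. mobius s u) = (if s = t then 1 else 0)"
proof (cases "s = t")
  case True
  then have "{u. s \<le>\<^sub>T u \<and> u \<le>\<^sub>T t} = {t}"
    by (auto intro: tamari_le.refl dest: tamari_le_antisym)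
  then show ?thesis using True by (simp add: mobius.simps[of t t])
next
  case False
  have "finite {u. s \<le>\<^sub>T u \<and> u \<le>\<^sub>T t \<and> u \<noteq> t}"
    by (rule finite_subset[OF _ finite_tamari_below[of t]]) auto
  moreover have "{u. s \<le>\<^sub>T u \<and> u \<le>\<^sub>T t} = insert t {u. s \<le>\<^sub>T u \<and> u \<le>\<^sub>T t \<and> u \<noteq> t}"
    using assms by (auto intro: tamari_le.refl)
  ultimately show ?thesis using False assms by (simp add: mobius.simps[of s t])
qed

lemma sum_single:
  "(\<Sum>i\<in>A. Poly_Mapping.single k (f i)) = Poly_Mapping.single k (\<Sum>i\<in>A. f i)"
  by (induction A rule: infinite_finite_induct) (auto simp: single_add)

lemma sum_M_tamari_below:
  "(\<Sum>u | u \<le>\<^sub>T t. M (Some u) :: 'k::field H) = Poly_Mapping.single (Some t) 1"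
proof -
  let ?f = "\<lambda>u w. Poly_Mapping.single (Some w) (of_int (mobius w u) :: 'k)"
  have "(\<Sum>u | u \<le>\<^sub>T t. M (Some u) :: 'k H) =
      (\<Sum>u | u \<le>\<^sub>T t. \<Sum>w | w \<in> {w. w \<le>\<^sub>T t} \<and> w \<le>\<^sub>T u. ?f u w)"
    unfolding M.simps by (intro sum.cong) (auto intro: tamari_le.trans)
  \<comment> \<open>After the exchange, the coefficient of \<open>w\<close> is the sum of
    \<open>mobius w\<close> over the interval from \<open>w\<close> to \<open>t\<close>.\<close>
  also have "\<dots> = (\<Sum>w | w \<le>\<^sub>T t. \<Sum>u | u \<in> {u. u \<le>\<^sub>T t} \<and> w \<le>\<^sub>T u. ?f u w)"
    by (rule sum.swap_restrict) (rule finite_tamari_below)+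
  also have "\<dots> = (\<Sum>w | w \<le>\<^sub>T t. if w = t then Poly_Mapping.single (Some t) 1 else 0)"
  proof (rule sum.cong)
    fix w assume "w \<in> {w. w \<le>\<^sub>T t}"
    then have w: "w \<le>\<^sub>T t" by simp
    have "(\<Sum>u | u \<in> {u. u \<le>\<^sub>T t} \<and> w \<le>\<^sub>T u. ?f u w) =
        Poly_Mapping.single (Some w) (of_int (\<Sum>u | w \<le>\<^sub>T u \<and> u \<le>\<^sub>T t. mobius w u))"
      by (simp add: sum_single conj_commute)
    then show "(\<Sum>u | u \<in> {u. u \<le>\<^sub>T t} \<and> w \<le>\<^sub>T u. ?f u w) =
        (if w = t then Poly_Mapping.single (Some t) 1 else 0)"
      using sum_mobius[OF w] by simp
  qed simp
  also have "\<dots> = Poly_Mapping.single (Some t) 1"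
    using finite_tamari_below[of t] by (simp add: sum.delta' tamari_le.refl)
  finally show ?thesis .
qed

lemma sum_M_below: "(\<Sum>z | z \<le>\<^sub>B b. M z :: 'k::field H) = Poly_Mapping.single b 1"
proof (cases b)
  case (Some t)
  then show ?thesis
    using sum_M_tamari_below[of t, where 'k='k]
    by (simp add: below_Some sum.reindex del: M.simps)
qed (simp add: below_None)

text \<open>Induction along \<open>right_weight\<close>: the terms strictly below \<open>t\<close>
  already agree and cancel.\<close>

lemma eq_of_sum_below_eq:
  fixes F G :: "pbt \<Rightarrow> 'a::ab_group_add"
  assumes "\<And>t. (\<Sum>w | w \<le>\<^sub>T t. F w) = (\<Sum>w | w \<le>\<^sub>T t. G w)"
  shows "F t = G t"
proof (induction "right_weight t" arbitrary: t rule: less_induct)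
  case less
  have "finite {w. w \<le>\<^sub>T t \<and> w \<noteq> t}"
    by (rule finite_subset[OF _ finite_tamari_below[of t]]) auto
  moreover have "{w. w \<le>\<^sub>T t} = insert t {w. w \<le>\<^sub>T t \<and> w \<noteq> t}"
    by (auto intro: tamari_le.refl)
  ultimately have split: "(\<Sum>w | w \<le>\<^sub>T t. f w) = f t + (\<Sum>w | w \<le>\<^sub>T t \<and> w \<noteq> t. f w)"
    for f :: "pbt \<Rightarrow> 'a" by simp
  have "(\<Sum>w | w \<le>\<^sub>T t \<and> w \<noteq> t. F w) = (\<Sum>w | w \<le>\<^sub>T t \<and> w \<noteq> t. G w)"
    using less right_weight_mono by (intro sum.cong) auto
  then show ?case using assms[of t] by (simp add: split)
qed

section \<open>The coproduct in the basis \<open>M\<close>\<close>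

lemma coprod_tree_eq_sum_M:
  "(coprod_tree t :: 'k::field HH) =
    (\<Sum>w | w \<le>\<^sub>T t. \<Sum>(z1, z2) | z1 \<rightthreetimes> z2 = Some w. M z1 \<otimes> M z2)"
proof -
  let ?m = "\<lambda>(z1, z2). M z1 \<otimes> M z2 :: 'k HH"
  let ?P = "\<lambda>w. {(z1, z2). z1 \<rightthreetimes> z2 = Some w}"
  let ?A = "\<Union>w\<in>{w. w \<le>\<^sub>T t}. ?P w"
  have A: "?A = {(z1, z2). z1 \<rightthreetimes> z2 \<le>\<^sub>B Some t}"
    by (auto simp: basis_le_Some_iff)
  have fin: "finite ?A"
    using finite_tamari_below finite_rprod_factors by blast
  have "(coprod_tree t :: 'k HH) = (\<Sum>i\<le>leaves t.
      (\<Sum>z | z \<le>\<^sub>B lcut i t. M z) \<otimes> (\<Sum>z | z \<le>\<^sub>B rcut i t. M z))"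
    by (simp add: coprod_tree_eq_cuts sum_M_below tensor_single)
  \<comment> \<open>By the adjunction, the pairs whose product lies below \<open>t\<close> and whose
    first factor has \<open>i\<close> leaves form a product of two principal down-sets.\<close>
  also have "\<dots> = (\<Sum>i\<le>leaves t. \<Sum>p | p \<in> ?A \<and> bleaves (fst p) = i. ?m p)"
  proof (rule sum.cong)
    fix i assume "i \<in> {..leaves t}"
    then have "z1 \<le>\<^sub>B lcut i t \<and> z2 \<le>\<^sub>B rcut i t \<longleftrightarrow>
        bleaves z1 = i \<and> z1 \<rightthreetimes> z2 \<le>\<^sub>B Some t" for z1 z2
      by (intro rprod_le_iff_cuts) simp
    then have "{z. z \<le>\<^sub>B lcut i t} \<times> {z. z \<le>\<^sub>B rcut i t} = {p. p \<in> ?A \<and> bleaves (fst p) = i}"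
      unfolding A by (simp add: set_eq_iff conj_commute)
    then show "(\<Sum>z | z \<le>\<^sub>B lcut i t. M z) \<otimes> (\<Sum>z | z \<le>\<^sub>B rcut i t. M z) =
        (\<Sum>p | p \<in> ?A \<and> bleaves (fst p) = i. ?m p)"
      by (simp only: tensor_sum)
  qed simp
  also have "\<dots> = (\<Sum>p\<in>?A. ?m p)"
  proof (rule sum.group[OF fin])
    show "(\<lambda>p. bleaves (fst p)) ` ?A \<subseteq> {..leaves t}"
      unfolding A by (auto dest!: basis_le_bleaves simp: bleaves_rprod)
  qed simp
  \<comment> \<open>The same pairs are now grouped by the value \<open>w\<close> of their
    product.\<close>
  also have "\<dots> = (\<Sum>w | w \<le>\<^sub>T t. \<Sum>p\<in>?P w. ?m p)"
    by (rule sum.UNION_disjoint)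
      (use finite_tamari_below finite_rprod_factors in \<open>auto simp del: rprod.simps\<close>)
  finally show ?thesis .
qed

theorem theorem2p29:
  fixes n :: nat and t :: pbt
  assumes "1 \<le> n" and "t \<in> PBT n"
  shows "coprod (M (Some t) :: 'k::field H) =
    (\<Sum>(z1, z2) | z1 \<rightthreetimes> z2 = Some t. M z1 \<otimes> M z2)"
proof (rule eq_of_sum_below_eq)
  fix t
  have "(\<Sum>w | w \<le>\<^sub>T t. coprod (M (Some w) :: 'k H)) = coprod (\<Sum>w | w \<le>\<^sub>T t. M (Some w))"
    by (simp only: coprod_def lin_ext_sum)
  also have "\<dots> = coprod_tree t"
    by (simp only: sum_M_tamari_below coprod_def lin_ext_single coprod_basis.simps)
  finally show "(\<Sum>w | w \<le>\<^sub>T t. coprod (M (Some w) :: 'k H)) =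
      (\<Sum>w | w \<le>\<^sub>T t. \<Sum>(z1, z2) | z1 \<rightthreetimes> z2 = Some w. M z1 \<otimes> M z2)"
    by (simp only: coprod_tree_eq_sum_M)
qed

end
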